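(* Let $\pi\colon (T,X)\to (T,Y)$ be an extension of minimal compact semiflows, where $T$ is a discrete monoid (in particular this covers the case that $T$ is a discrete group). Suppose $L\subseteq \mathtt{R}_\pi$ is a closed $T$-invariant AP-transitive relation for $\pi$ on $X$ such that (a) $L$ contains a dense set of a.p. points of the semiflow $(T,L)$, and (b) $\mathtt{RP}_{\pi|L}=L$. Then $(T,L)$ is an M-semiflow, i.e. it is topologically transitive and has a dense set of a.p. points.
   Context: An extension $\pi\colon(T,X)\to(T,Y)$ is a continuous surjection with $\pi(tx)=t\pi(x)$ for all $t\in T$, $x\in X$. Put $\mathtt{R}_\pi=\{(x_1,x_2)\in X\times X:\pi x_1=\pi x_2\}$, on which $T$ acts diagonally, and let $\Delta_X$ denote the diagonal of $X\times X$. A subset $A\subseteq T$ is syndetic if there is a compact (here: finite) $K\subseteq T$ with $Kt\cap A\neq\emptyset$ for all $t\in T$. A point $z$ of a dynamic $(T,Z)$ is almost periodic (a.p.) if $\{t\in T: tz\in U\}$ is syndetic for every neighborhood $U$ of $z$. A dynamic $(T,Z)$ is topologically transitive (T.T.) if for all nonempty open $U,V\subseteq Z$ there is $t\in T$ with $V\cap tU\neq\emptyset$. A dynamic is an M-dynamic (M-semiflow, M-flow) if it is T.T. and has a dense set of a.p. points. A nonempty set $L\subseteq\mathtt{R}_\pi$ is an AP-transitive relation for $\pi$ on $X$ if $L$ is reflexive and symmetric as a relation on $X$, and whenever $(x_1,x_2)\in L$ and $(x_2,x_3)\in L$ are both a.p. points of $(T,X\times X)$, then $(x_1,x_3)\in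 L$. For $L\subseteq\mathtt{R}_\pi$, $\mathtt{RP}_{\pi|L}$ is the set of $\tilde x\in L$ for which there exist nets $\tilde x_j\in L$, $t_j\in T$ and a point $\tilde x'\in\Delta_X$ with $\tilde x_j\to\tilde x$ and $t_j\tilde x_j\to\tilde x'$. *)

theory Defs
  imports "HOL-Analysis.Analysis"
begin

definition semiflow :: "('t::monoid_mult \<Rightarrow> 'x::topological_space \<Rightarrow> 'x) \<Rightarrow> bool" where
  "semiflow act \<longleftrightarrow> (\<forall>x. act 1 x = x) \<and> (\<forall>s t x. act (s * t) x = act s (act t x))
     \<and> (\<forall>t. continuous_on UNIV (act t))"

definition minimal_dyn :: "('t::monoid_mult \<Rightarrow> 'x::topological_space \<Rightarrow> 'x) \<Rightarrow> bool" where
  "minimal_dyn act \<longleftrightarrow> (\<forall>A. closed A \<and> A \<noteq> {} \<and> (\<forall>t. act t ` A \<subseteq> A) \<longrightarrow> A = UNIV)"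

definition extension ::
  "('t::monoid_mult \<Rightarrow> 'x::topological_space \<Rightarrow> 'x) \<Rightarrow> ('t \<Rightarrow> 'y::topological_space \<Rightarrow> 'y) \<Rightarrow> ('x \<Rightarrow> 'y) \<Rightarrow> bool" where
  "extension actX actY p \<longleftrightarrow> continuous_on UNIV p \<and> surj p \<and> (\<forall>t x. p (actX t x) = actY t (p x))"

definition Rpi :: "('x \<Rightarrow> 'y) \<Rightarrow> ('x \<times> 'x) set" where
  "Rpi p = {(x1, x2). p x1 = p x2}"

definition act2 :: "('t \<Rightarrow> 'x \<Rightarrow> 'x) \<Rightarrow> 't \<Rightarrow> 'x \<times> 'x \<Rightarrow> 'x \<times> 'x" where
  "act2 act t z = (act t (fst z), act t (snd z))"

definition syndetic :: "'t::monoid_mult set \<Rightarrow> bool" where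
  "syndetic A \<longleftrightarrow> (\<exists>K. finite K \<and> (\<forall>t. \<exists>k\<in>K. k * t \<in> A))"

definition ap_point :: "('t::monoid_mult \<Rightarrow> 'z::topological_space \<Rightarrow> 'z) \<Rightarrow> 'z \<Rightarrow> bool" where
  "ap_point act z \<longleftrightarrow> (\<forall>U. open U \<and> z \<in> U \<longrightarrow> syndetic {t. act t z \<in> U})"

definition top_trans :: "('t \<Rightarrow> 'z::topological_space \<Rightarrow> 'z) \<Rightarrow> 'z set \<Rightarrow> bool" where
  "top_trans act Z \<longleftrightarrow> (\<forall>U V. openin (top_of_set Z) U \<and> U \<noteq> {} \<and> openin (top_of_set Z) V \<and> V \<noteq> {}
      \<longrightarrow> (\<exists>t. V \<inter> act t ` U \<noteq> {}))"

definition dense_ap :: "('t::monoid_mult \<Rightarrow> 'z::topological_space \<Rightarrow> 'z) \<Rightarrow> 'z set \<Rightarrow> bool" where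
  "dense_ap act Z \<longleftrightarrow> Z \<subseteq> closure {z\<in>Z. ap_point act z}"

definition M_dyn :: "('t::monoid_mult \<Rightarrow> 'z::topological_space \<Rightarrow> 'z) \<Rightarrow> 'z set \<Rightarrow> bool" where
  "M_dyn act Z \<longleftrightarrow> top_trans act Z \<and> dense_ap act Z"

definition AP_transitive ::
  "('t::monoid_mult \<Rightarrow> 'x::topological_space \<Rightarrow> 'x) \<Rightarrow> ('x \<Rightarrow> 'y) \<Rightarrow> ('x \<times> 'x) set \<Rightarrow> bool" where
  "AP_transitive act p L \<longleftrightarrow> L \<noteq> {} \<and> L \<subseteq> Rpi p \<and> (\<forall>x. (x, x) \<in> L)
     \<and> (\<forall>x1 x2. (x1, x2) \<in> L \<longrightarrow> (x2, x1) \<in> L)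
     \<and> (\<forall>x1 x2 x3. (x1, x2) \<in> L \<and> (x2, x3) \<in> L \<and> ap_point (act2 act) (x1, x2)
          \<and> ap_point (act2 act) (x2, x3) \<longrightarrow> (x1, x3) \<in> L)"

text \<open>RP_{pi|L}: nets (x_j, t_j) are encoded by a proper filter F on (X \<times> X) \<times> T:
  eventually x_j \<in> L, x_j \<rightarrow> z and t_j x_j \<rightarrow> (x', x') on the diagonal.\<close>
definition RP_rel :: "('t::monoid_mult \<Rightarrow> 'x::topological_space \<Rightarrow> 'x) \<Rightarrow> ('x \<times> 'x) set \<Rightarrow> ('x \<times> 'x) set" where
  "RP_rel act L = {z \<in> L. \<exists>(F :: (('x \<times> 'x) \<times> 't) filter) x'. F \<noteq> bot
      \<and> eventually (\<lambda>w. fst w \<in> L) F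
      \<and> (fst \<longlongrightarrow> z) F
      \<and> ((\<lambda>w. act2 act (snd w) (fst w)) \<longlongrightarrow> (x', x')) F}"

end

theory Submission
  imports Defs
begin

text \<open>
  Let \<open>M\<close> be a minimal left ideal of the Ellis semigroup of \<open>X\<close>; the almost periodic pairs are those
  fixed by some idempotent of \<open>M\<close>. If \<open>N \<subseteq> L\<close> is closed, invariant and contains a neighbourhood in \<open>L\<close>
  of an almost periodic pair \<open>(a, b)\<close>, fixed by \<open>u\<close> say, then every almost periodic orbit closure in
  \<open>L\<close> contains some \<open>u\<close>-fixed \<open>(a, e)\<close>, and AP-transitivity gives \<open>(b, e) \<in> L\<close>. Regional proximality
  of \<open>(b, e)\<close> and density provide nets \<open>m\<^sub>j \<rightarrow> m\<close>, \<open>n\<^sub>j \<rightarrow> n\<close> in \<open>M\<close> and \<open>u\<close>-fixed points \<open>\<beta>\<^sub>j\<close> with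
  \<open>m\<^sub>j (b, \<beta>\<^sub>j) \<rightarrow> (b, e)\<close> and \<open>n\<^sub>j (b, \<beta>\<^sub>j) \<rightarrow> (n b, n b)\<close>. Put \<open>g = u m\<close>, which lies in the group \<open>u M\<close>
  and fixes \<open>b\<close>, and \<open>z = g\<^sup>-\<^sup>1 a\<close>. An element of \<open>M\<close> takes \<open>n (z, b)\<close> to \<open>(a, b)\<close>, so the orbit of
  \<open>(z, \<beta>\<^sub>j)\<close> eventually enters \<open>N\<close>; being almost periodic, \<open>(z, \<beta>\<^sub>j) \<in> N\<close>. Hence \<open>(m z, e) \<in> N\<close>, and
  applying \<open>u\<close> yields \<open>(a, e) \<in> N\<close>.
\<close>

section \<open>Compactness and separation in function spaces\<close>

lemma compact_UNIV_fun:
  assumes "compact (UNIV :: 'b::topological_space set)"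
  shows "compact (UNIV :: ('a \<Rightarrow> 'b) set)"
proof -
  have "compact_space (product_topology (\<lambda>_::'a. euclidean :: 'b topology) UNIV)"
    using assms by (metis compact_space_def compact_space_product_topology compactin_euclidean_iff
        topspace_euclidean)
  then show ?thesis
    by (simp add: euclidean_product_topology compact_space_def)
qed

lemma Hausdorff_space_euclidean_t2: "Hausdorff_space (euclidean :: 'a::t2_space topology)"
  using hausdorff by (fastforce simp: Hausdorff_space_def disjnt_def)

lemma t2_separate_point_compact:
  fixes x :: "'a::t2_space"
  assumes "compact S" "x \<notin> S"
  obtains U V where "open U" "open V" "x \<in> U" "S \<subseteq> V" "U \<inter> V = {}"
proof -
  have "compactin euclidean {x}" "compactin euclidean S" "disjnt {x} S"
    using assms by auto
  then obtain U V where "openin euclidean U" "openin euclidean V" "{x} \<subseteq> U" "S \<subseteq> V" "disjnt U V"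
    by (rule Hausdorff_space_compact_separation[OF Hausdorff_space_euclidean_t2])
  then show thesis
    using that[of U V] by (simp add: disjnt_def)
qed

text \<open>The type class instance of Hausdorff function spaces cannot be declared: it clashes with the
  existing arity for countable domains and metric codomains.\<close>

lemma compact_imp_closed_fun:
  fixes A :: "('a \<Rightarrow> 'b::t2_space) set"
  assumes "compact A"
  shows "closed A"
proof -
  have "Hausdorff_space (product_topology (\<lambda>_::'a. euclidean :: 'b topology) UNIV)"
    by (simp add: Hausdorff_space_product_topology Hausdorff_space_euclidean_t2)
  then have "Hausdorff_space (euclidean :: ('a \<Rightarrow> 'b) topology)"
    by (simp add: euclidean_product_topology)
  then show ?thesis
    using compactin_imp_closedin[of euclidean A] assms by simp
qed

section \<open>Minimal closed sets and idempotents\<close>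

text \<open>Zorn's lemma for reverse inclusion: a chain of nonempty closed sets has nonempty
  intersection by compactness, and \<open>P_Inter\<close> preserves \<open>P\<close>. It serves both
  minimal closed subsemigroups and minimal closed left ideals.\<close>

lemma compact_minimal_closed_subset:
  fixes S :: "'a::topological_space set"
  assumes "compact (UNIV :: 'a set)" and S: "closed S" "S \<noteq> {}" "P S"
    and P_Inter: "\<And>C. C \<noteq> {} \<Longrightarrow> (\<And>A. A \<in> C \<Longrightarrow> P A) \<Longrightarrow> P (\<Inter>C)"
  obtains A where "A \<subseteq> S" "closed A" "A \<noteq> {}" "P A"
    "\<And>B. \<lbrakk>B \<subseteq> A; closed B; B \<noteq> {}; P B\<rbrakk> \<Longrightarrow> B = A"
proof -
  define \<A> where "\<A> = {A. A \<subseteq> S \<and> closed A \<and> A \<noteq> {} \<and> P A}"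
  \<comment> \<open>Complements turn the maximal elements supplied by Zorn into minimal
    ones.\<close>
  have "\<exists>M\<in>uminus ` \<A>. \<forall>X\<in>uminus ` \<A>. M \<subseteq> X \<longrightarrow> X = M"
  proof (rule subset_Zorn_nonempty)
    show "uminus ` \<A> \<noteq> {}"
      using S by (auto simp: \<A>_def)
  next
    fix \<C> assume \<C>: "\<C> \<noteq> {}" "subset.chain (uminus ` \<A>) \<C>"
    define \<D> where "\<D> = uminus ` \<C>"
    have \<D>: "\<D> \<subseteq> \<A>" "\<D> \<noteq> {}"
      using \<C> by (auto simp: \<D>_def subset.chain_def)
    have chain: "A \<subseteq> B \<or> B \<subseteq> A" if AB: "A \<in> \<D>" "B \<in> \<D>" for A B
    proof -
      obtain A' B' where "A' \<in> \<C>" "B' \<in> \<C>" "A = - A'" "B = - B'"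
        using AB unfolding \<D>_def by blast
      moreover from this have "A' \<subseteq> B' \<or> B' \<subseteq> A'"
        using subset.chain_total[OF \<C>(2)] by blast
      ultimately show ?thesis by blast
    qed
    have fin: "\<exists>A\<in>\<D>. A \<subseteq> \<Inter>F" if "finite F" "F \<subseteq> \<D>" for F
      using that
    proof (induction F)
      case empty
      then show ?case using \<D> by auto
    next
      case (insert B F)
      then obtain A where "A \<in> \<D>" "A \<subseteq> \<Inter>F" by auto
      moreover have "B \<in> \<D>" using insert by auto
      ultimately show ?case
        using chain[of A B] by (metis Inter_insert le_inf_iff order_refl order_trans)
    qed
    have "UNIV \<inter> \<Inter>\<D> \<noteq> {}"
    proof (rule compact_imp_fip[OF assms(1)])
      show "closed A" if "A \<in> \<D>" for A
        using that \<D> by (auto simp: \<A>_def)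
    next
      fix F assume "finite F" "F \<subseteq> \<D>"
      from fin[OF this] show "UNIV \<inter> \<Inter>F \<noteq> {}"
        using \<D> by (force simp: \<A>_def)
    qed
    moreover have "P (\<Inter>\<D>)"
      by (rule P_Inter) (use \<D> in \<open>auto simp: \<A>_def\<close>)
    moreover have "closed (\<Inter>\<D>)" "\<Inter>\<D> \<subseteq> S"
      using \<D> by (auto simp: \<A>_def)
    ultimately have "\<Inter>\<D> \<in> \<A>"
      by (auto simp: \<A>_def)
    moreover have "\<Union>\<C> = - \<Inter>\<D>"
      by (auto simp: \<D>_def)
    ultimately show "\<Union>\<C> \<in> uminus ` \<A>"
      by blast
  qed
  then obtain A where A: "A \<in> \<A>" "\<And>B. B \<in> \<A> \<Longrightarrow> B \<subseteq> A \<Longrightarrow> B = A"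
    by (auto simp: ball_simps)
  show thesis
    by (rule that[of A]) (use A in \<open>auto simp: \<A>_def\<close>)
qed

lemma continuous_on_comp_right: "continuous_on UNIV (\<lambda>p :: 'b \<Rightarrow> 'c::topological_space. p \<circ> q)"
  by (rule continuous_on_coordinatewise_then_product) simp

lemma continuous_on_eval_pair:
  "continuous_on A (\<lambda>p :: 'a \<Rightarrow> 'c::topological_space. (p x, p y))"
  by (intro continuous_on_Pair continuous_on_subset[OF continuous_on_product_coordinates]) auto

text \<open>Ellis--Numakura; only right translations need to be continuous.\<close>

lemma idempotent_in_closed_subsemigroup:
  fixes S :: "('x::t2_space \<Rightarrow> 'x) set"
  assumes "compact (UNIV :: 'x set)" and "closed S" "S \<noteq> {}"
    and "\<And>p q. p \<in> S \<Longrightarrow> q \<in> S \<Longrightarrow> p \<circ> q \<in> S"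
  obtains v where "v \<in> S" "v \<circ> v = v"
proof -
  have cpt: "compact (UNIV :: ('x \<Rightarrow> 'x) set)"
    by (rule compact_UNIV_fun) fact
  let ?P = "\<lambda>A. \<forall>p\<in>A. \<forall>q\<in>A. p \<circ> q \<in> A"
  have PS: "?P S" using assms(4) by blast
  have PI: "?P (\<Inter>C)" if "\<And>A. A \<in> C \<Longrightarrow> ?P A" for C :: "('x \<Rightarrow> 'x) set set"
    using that by blast
  obtain A where A: "A \<subseteq> S" "closed A" "A \<noteq> {}" "?P A"
    and min: "\<And>B. \<lbrakk>B \<subseteq> A; closed B; B \<noteq> {}; ?P B\<rbrakk> \<Longrightarrow> B = A"
    using compact_minimal_closed_subset[of S ?P, OF cpt assms(2,3) PS PI] by metis
  obtain v where v: "v \<in> A" using A by blast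
  have "compact A"
    using cpt A by (metis compact_Int_closed inf_top_left)
  then have "closed ((\<lambda>p. p \<circ> v) ` A)"
    by (intro compact_imp_closed_fun compact_continuous_image
        continuous_on_subset[OF continuous_on_comp_right]) auto
  moreover have "?P ((\<lambda>p. p \<circ> v) ` A)"
  proof (intro ballI)
    fix p q assume "p \<in> (\<lambda>p. p \<circ> v) ` A" "q \<in> (\<lambda>p. p \<circ> v) ` A"
    then obtain p' q' where "p' \<in> A" "q' \<in> A" "p = p' \<circ> v" "q = q' \<circ> v" by auto
    then show "p \<circ> q \<in> (\<lambda>p. p \<circ> v) ` A"
      using A v by (intro image_eqI[of _ _ "p' \<circ> (v \<circ> q')"]) (auto simp: comp_assoc)
  qed
  \<comment> \<open>The right translate of \<open>A\<close> by \<open>v\<close> is a closed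
    subsemigroup of \<open>A\<close>, hence all of \<open>A\<close>; so
    \<open>w \<circ> v = v\<close> is solvable in \<open>A\<close>.\<close>
  ultimately have "(\<lambda>p. p \<circ> v) ` A = A"
    using A v by (intro min) auto
  then obtain w where w: "w \<in> A" "w \<circ> v = v"
    using v by (metis imageE)
  have "closed {p. p \<circ> v = v}"
    unfolding fun_eq_iff comp_apply
    by (intro closed_Collect_all closed_Collect_eq continuous_on_product_coordinates
        continuous_on_const)
  \<comment> \<open>The solutions again form a nonempty closed subsemigroup of \<open>A\<close>, so
    \<open>v\<close> is among them.\<close>
  then have "A \<inter> {p. p \<circ> v = v} = A"
    using A w by (intro min) (auto simp: comp_assoc)
  then show thesis
    using v A that by blast
qed

section \<open>The Ellis semigroup of a compact semiflow\<close>

locale compact_semiflow =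
  fixes act :: "'t::monoid_mult \<Rightarrow> 'x::t2_space \<Rightarrow> 'x"
  assumes compact_space: "compact (UNIV :: 'x set)"
    and semiflow: "semiflow act"
begin

text \<open>The Ellis (enveloping) semigroup; the closure is that of pointwise convergence.\<close>

definition ellis :: "('x \<Rightarrow> 'x) set" where
  "ellis = closure (range act)"

text \<open>Only translations are asked to preserve \<open>I\<close>. For closed \<open>I\<close>
  this extends to all of \<open>ellis\<close>, because right multiplication by a fixed map is
  continuous.\<close>

definition left_ideal :: "('x \<Rightarrow> 'x) set \<Rightarrow> bool" where
  "left_ideal I \<longleftrightarrow> (\<forall>t. \<forall>p\<in>I. act t \<circ> p \<in> I)"

lemma act_one [simp]: "act 1 x = x"
  and act_mult: "act (s * t) x = act s (act t x)"
  and act_continuous: "continuous_on UNIV (act t)"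
  using semiflow by (auto simp: semiflow_def)

lemma act2_continuous: "continuous_on UNIV (act2 act t)"
  unfolding act2_def
  by (intro continuous_on_Pair continuous_on_compose2[OF act_continuous] continuous_intros) auto

lemma act_in_ellis: "act t \<in> ellis"
  unfolding ellis_def by (rule subsetD[OF closure_subset]) simp

lemma compact_closed_fun: "closed A \<Longrightarrow> compact (A :: ('x \<Rightarrow> 'x) set)"
  using compact_UNIV_fun[OF compact_space] by (metis compact_Int_closed inf_top_left)

lemma ellis_comp_left_ideal:
  assumes "left_ideal I" "closed I" "p \<in> ellis" "q \<in> I"
  shows "p \<circ> q \<in> I"
proof -
  have "(\<lambda>p. p \<circ> q) ` closure (range act) \<subseteq> I"
    by (rule image_closure_subset[OF continuous_on_subset[OF continuous_on_comp_right]])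
      (use assms in \<open>auto simp: left_ideal_def\<close>)
  then show ?thesis
    using assms by (auto simp: ellis_def)
qed

lemma left_ideal_ellis: "left_ideal ellis"
  unfolding left_ideal_def
proof (intro allI ballI)
  fix t p assume "p \<in> ellis"
  have "continuous_on UNIV (\<lambda>p. act t \<circ> p)"
    by (rule continuous_on_coordinatewise_then_product)
      (auto intro!: continuous_on_compose2[OF act_continuous])
  then have "(\<lambda>p. act t \<circ> p) ` closure (range act) \<subseteq> ellis"
  proof (rule image_closure_subset[OF continuous_on_subset])
    have "act t \<circ> act s = act (t * s)" for s
      by (auto simp: act_mult)
    then show "(\<lambda>p. act t \<circ> p) ` range act \<subseteq> ellis"
      using act_in_ellis by auto
  qed (auto simp: ellis_def)
  then show "act t \<circ> p \<in> ellis"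
    using \<open>p \<in> ellis\<close> by (auto simp: ellis_def)
qed

text \<open>Evaluation at two points is continuous, so a single translation approximates
  \<open>p\<close> at both.\<close>

lemma ellis_approx_pair:
  assumes "p \<in> ellis" "open U" "(p x, p y) \<in> U"
  obtains t where "(act t x, act t y) \<in> U"
proof -
  have "open ((\<lambda>p. (p x, p y)) -` U)"
    using assms(2) by (rule open_vimage) (rule continuous_on_eval_pair)
  then have "range act \<inter> (\<lambda>p. (p x, p y)) -` U \<noteq> {}"
    using assms open_Int_closure_eq_empty[of "(\<lambda>p. (p x, p y)) -` U" "range act"]
    by (auto simp: ellis_def)
  then show thesis using that by auto
qed

lemma ellis_closed_invariant:
  assumes "p \<in> ellis" "closed N" "\<And>t. act2 act t ` N \<subseteq> N" "(x, y) \<in> N"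
  shows "(p x, p y) \<in> N"
proof (rule ccontr)
  assume "(p x, p y) \<notin> N"
  then obtain t where "(act t x, act t y) \<in> - N"
    using ellis_approx_pair[OF assms(1), of "- N" x y] assms(2) by auto
  then show False
    using assms(3)[of t] assms(4) by (force simp: act2_def)
qed

end

section \<open>Minimal left ideals and almost periodic pairs\<close>

locale ellis_minimal_ideal = compact_semiflow act
  for act :: "'t::monoid_mult \<Rightarrow> 'x::t2_space \<Rightarrow> 'x" +
  fixes M :: "('x \<Rightarrow> 'x) set"
  assumes M_ellis: "M \<subseteq> ellis" and M_closed: "closed M" and M_nonempty: "M \<noteq> {}"
    and M_left_ideal: "left_ideal M"
    and M_minimal: "\<And>I. \<lbrakk>I \<subseteq> M; closed I; I \<noteq> {}; left_ideal I\<rbrakk> \<Longrightarrow> I = M"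
begin

lemma M_comp: "p \<in> ellis \<Longrightarrow> q \<in> M \<Longrightarrow> p \<circ> q \<in> M"
  using ellis_comp_left_ideal M_closed M_left_ideal by blast

lemma M_compact: "compact M"
  using M_closed by (rule compact_closed_fun)

text \<open>The right translate of \<open>M\<close> by \<open>p\<close> is a closed left ideal
  inside \<open>M\<close>, so by minimality it is \<open>M\<close>.\<close>

lemma M_solve_left:
  assumes "p \<in> M" "q \<in> M"
  obtains r where "r \<in> M" "r \<circ> p = q"
proof -
  have "(\<lambda>r. r \<circ> p) ` M = M"
  proof (rule M_minimal)
    show "(\<lambda>r. r \<circ> p) ` M \<subseteq> M"
      using assms M_ellis M_comp by auto
    show "closed ((\<lambda>r. r \<circ> p) ` M)"
      by (intro compact_imp_closed_fun compact_continuous_image M_compact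
          continuous_on_subset[OF continuous_on_comp_right]) auto
    show "(\<lambda>r. r \<circ> p) ` M \<noteq> {}"
      using M_nonempty by simp
    show "left_ideal ((\<lambda>r. r \<circ> p) ` M)"
      using M_left_ideal unfolding left_ideal_def by (auto simp: image_iff) (metis comp_assoc)
  qed
  then show thesis
    using assms that by (metis imageE)
qed

lemma idempotent_right_unit:
  assumes "v \<in> M" "v \<circ> v = v" "p \<in> M"
  shows "p \<circ> v = p"
  using M_solve_left[OF assms(1,3)] assms(2) by (metis comp_assoc)

text \<open>This is the group structure of \<open>v \<circ> M\<close> with unit \<open>v\<close>:
  left inverses come from \<open>M_solve_left\<close>, and a left inverse that itself has a left
  inverse is two-sided.\<close>

lemma idempotent_group_inverse:
  assumes "v \<in> M" "v \<circ> v = v" "p \<in> M" "v \<circ> p = p"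
  obtains q where "q \<in> M" "v \<circ> q = q" "q \<circ> p = v" "p \<circ> q = v"
proof -
  have left: "\<exists>q\<in>M. v \<circ> q = q \<and> q \<circ> p = v" if p: "p \<in> M" for p
  proof -
    obtain r where "r \<in> M" "r \<circ> p = v"
      using M_solve_left[OF p assms(1)] .
    then show ?thesis
      using assms(1,2) M_comp M_ellis by (intro bexI[of _ "v \<circ> r"]) (metis comp_assoc, blast)
  qed
  obtain q where q: "q \<in> M" "v \<circ> q = q" "q \<circ> p = v"
    using left assms(3) by blast
  obtain r where r: "r \<in> M" "v \<circ> r = r" "r \<circ> q = v"
    using left q by blast
  \<comment> \<open>\<open>r = r \<circ> v = r \<circ> q \<circ> p = v \<circ> p = p\<close>.\<close>
  have "r = p"
    using q r assms idempotent_right_unit by (metis comp_assoc)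
  then show thesis
    using that q r by blast
qed

text \<open>The elements of \<open>M\<close> fixing both coordinates form a closed subsemigroup,
  which contains an idempotent once it is nonempty. Were it empty, the compact
  \<open>M\<close>-orbit of the pair could be separated from the pair, against syndeticity.\<close>

lemma ap_point_imp_idempotent:
  assumes "ap_point (act2 act) (x, y)"
  obtains v where "v \<in> M" "v \<circ> v = v" "v x = x" "v y = y"
proof -
  define S where "S = M \<inter> {p. (p x, p y) = (x, y)}"
  have "closed S"
    unfolding S_def
    by (intro closed_Int M_closed closed_Collect_eq continuous_on_eval_pair continuous_on_const)
  moreover have "p \<circ> q \<in> S" if "p \<in> S" "q \<in> S" for p q
    using that M_comp M_ellis by (auto simp: S_def)
  moreover have "S \<noteq> {}"
  proof
    assume "S = {}"
    let ?O = "(\<lambda>p. (p x, p y)) ` M"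
    have "compact ?O"
      by (intro compact_continuous_image M_compact continuous_on_eval_pair)
    moreover have "(x, y) \<notin> ?O"
      using \<open>S = {}\<close> by (auto simp: S_def)
    ultimately obtain U V where UV: "open U" "open V" "(x, y) \<in> U" "?O \<subseteq> V" "U \<inter> V = {}"
      by (rule t2_separate_point_compact)
    have "syndetic {t. act2 act t (x, y) \<in> U}"
      using assms UV(1,3) by (simp add: ap_point_def)
    then obtain K where K: "finite K" "\<And>t. \<exists>k\<in>K. act2 act (k * t) (x, y) \<in> U"
      by (auto simp: syndetic_def)
    obtain p where p: "p \<in> M"
      using M_nonempty by blast
    have "act2 act k (p x, p y) \<in> V" for k
      using M_left_ideal p UV(4) by (force simp: left_ideal_def act2_def)
    moreover have "open (\<Inter>k\<in>K. act2 act k -` V)"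
      using K(1) UV(2) act2_continuous by (intro open_INT ballI open_vimage)
    \<comment> \<open>This \<open>t\<close> brings the pair so close to its image under
      \<open>p\<close> that every \<open>k\<close> in the finite set \<open>K\<close> then sends it
      into \<open>V\<close>, hence outside \<open>U\<close>.\<close>
    ultimately obtain t where "(act t x, act t y) \<in> (\<Inter>k\<in>K. act2 act k -` V)"
      using ellis_approx_pair[of p "\<Inter>k\<in>K. act2 act k -` V" x y] p M_ellis by auto
    then show False
      using K(2)[of t] UV(5) by (auto simp: act2_def act_mult)
  qed
  ultimately obtain v where "v \<in> S" "v \<circ> v = v"
    using idempotent_in_closed_subsemigroup[OF compact_space] by blast
  then show thesis
    using that by (auto simp: S_def)
qed

text \<open>Each point of the \<open>M\<close>-orbit of the pair can be led back to the pair within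
  \<open>M\<close>, hence into \<open>U\<close> by some translation; compactness of this orbit
  leaves finitely many translations.\<close>

lemma fixed_imp_ap_point:
  assumes "v \<in> M" "v x = x" "v y = y"
  shows "ap_point (act2 act) (x, y)"
  unfolding ap_point_def
proof (intro allI impI)
  fix U :: "('x \<times> 'x) set" assume U: "open U \<and> (x, y) \<in> U"
  let ?O = "(\<lambda>p. (p x, p y)) ` M"
  have "compact ?O"
    by (intro compact_continuous_image M_compact continuous_on_eval_pair)
  moreover have "open (act2 act t -` U)" for t
    using U act2_continuous by (intro open_vimage) auto
  moreover have "?O \<subseteq> (\<Union>t\<in>UNIV. act2 act t -` U)"
  proof clarify
    fix p assume "p \<in> M"
    then obtain r where r: "r \<in> M" "r \<circ> p = v"
      using M_solve_left assms(1) by blast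
    then have "r (p x) = x" "r (p y) = y"
      using assms by (metis comp_apply)+
    then show "(p x, p y) \<in> (\<Union>t\<in>UNIV. act2 act t -` U)"
      using ellis_approx_pair[of r U "p x" "p y"] r M_ellis U by (auto simp: act2_def)
  qed
  ultimately obtain K where K: "finite K" "?O \<subseteq> (\<Union>t\<in>K. act2 act t -` U)"
    by (rule compactE_image)
  have "\<exists>k\<in>K. k * t \<in> {t. act2 act t (x, y) \<in> U}" for t
  proof -
    have "act t \<circ> v \<in> M"
      using M_left_ideal assms by (auto simp: left_ideal_def)
    then have "(act t x, act t y) \<in> ?O"
      using assms by (intro image_eqI[of _ _ "act t \<circ> v"]) auto
    then show ?thesis
      using K by (fastforce simp: act2_def act_mult)
  qed
  then show "syndetic {t. act2 act t (x, y) \<in> U}"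
    using K by (auto simp: syndetic_def)
qed

section \<open>Regional proximality expressed in the minimal ideal\<close>

lemma M_orbit_eq_UNIV:
  assumes "minimal_dyn act"
  obtains p where "p \<in> M" "p x = y"
proof -
  have "closed ((\<lambda>p. p x) ` M)"
    by (intro compact_imp_closed compact_continuous_image M_compact
        continuous_on_subset[OF continuous_on_product_coordinates]) auto
  moreover have "act t ` (\<lambda>p. p x) ` M \<subseteq> (\<lambda>p. p x) ` M" for t
  proof clarify
    fix p assume "p \<in> M"
    then have "act t \<circ> p \<in> M"
      using M_left_ideal by (auto simp: left_ideal_def)
    then show "act t (p x) \<in> (\<lambda>p. p x) ` M"
      by (metis comp_apply image_eqI)
  qed
  ultimately have "(\<lambda>p. p x) ` M = UNIV"
    using assms M_nonempty unfolding minimal_dyn_def by (metis image_is_empty)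
  then show thesis
    using that by (metis UNIV_I imageE)
qed

text \<open>Regional proximality of \<open>(b, e)\<close> is witnessed by points of \<open>L\<close> whose first coordinate is pulled
  back to \<open>b\<close>, so that only the elements \<open>m\<close>, \<open>n\<close> of \<open>M\<close> and the second coordinate \<open>\<beta>\<close> vary.\<close>

lemma RP_rel_witness:
  assumes min: "minimal_dyn act"
    and L: "closed L" "\<And>t. act2 act t ` L \<subseteq> L" "dense_ap (act2 act) L"
    and u: "u \<in> M" "u \<circ> u = u" "u b = b"
    and x': "\<forall>W Q. open W \<and> z \<in> W \<and> open Q \<and> (x', x') \<in> Q \<longrightarrow>
      (\<exists>w t. w \<in> L \<and> w \<in> W \<and> act2 act t w \<in> Q)"
    and WQ: "open W" "z \<in> W" "open Q" "(x', x') \<in> Q"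
  obtains m n \<beta> where "m \<in> M" "n \<in> M" "u \<beta> = \<beta>" "(b, \<beta>) \<in> L" "(m b, m \<beta>) \<in> W" "(n b, n \<beta>) \<in> Q"
proof -
  obtain w t where wt: "w \<in> L" "w \<in> W" "act2 act t w \<in> Q"
    using x' WQ by blast
  have "open (W \<inter> act2 act t -` Q)"
    using WQ act2_continuous by (intro open_Int open_vimage)
  moreover have "w \<in> closure {z\<in>L. ap_point (act2 act) z}"
    using wt L(3) by (auto simp: dense_ap_def)
  ultimately have "(W \<inter> act2 act t -` Q) \<inter> {z\<in>L. ap_point (act2 act) z} \<noteq> {}"
    using wt open_Int_closure_eq_empty by blast
  then obtain y where "y \<in> W" "act2 act t y \<in> Q" "y \<in> L" "ap_point (act2 act) y"
    by blast
  then obtain y1 y2 where y: "(y1, y2) \<in> W" "act2 act t (y1, y2) \<in> Q" "(y1, y2) \<in> L"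
      "ap_point (act2 act) (y1, y2)"
    by (cases y) simp
  obtain v where v: "v \<in> M" "v \<circ> v = v" "v y1 = y1" "v y2 = y2"
    using ap_point_imp_idempotent[OF y(4)] .
  obtain p where p: "p \<in> M" "p b = y1"
    using M_orbit_eq_UNIV[OF min] .
  \<comment> \<open>Composing with \<open>v\<close> puts \<open>m\<close> into the group
    \<open>v \<circ> M\<close>, where it has an inverse \<open>q\<close>.\<close>
  define m where "m = v \<circ> p"
  have m: "m \<in> M" "v \<circ> m = m" "m b = y1"
    using v p M_comp M_ellis by (auto simp: m_def comp_assoc[symmetric])
  obtain q where q: "q \<in> M" "v \<circ> q = q" "q \<circ> m = v" "m \<circ> q = v"
    using idempotent_group_inverse[OF v(1,2) m(1,2)] .
  \<comment> \<open>The pair \<open>(y1, y2)\<close> is pulled back by \<open>u \<circ> q\<close> to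
    first coordinate \<open>b\<close>; \<open>m\<close> undoes this because
    \<open>m \<circ> u = m\<close>.\<close>
  define \<beta> where "\<beta> = u (q y2)"
  have mu: "m \<circ> u = m" and uv: "u \<circ> v = u"
    using idempotent_right_unit u v m by auto
  have m\<beta>: "m \<beta> = y2"
    using mu q(4) v(4) by (metis \<beta>_def comp_apply)
  have "q y1 = v b"
    using q(3) m(3) by (metis comp_apply)
  then have ub: "(u \<circ> q) y1 = b" and u\<beta>: "(u \<circ> q) y2 = \<beta>"
    using uv u(3) by (metis comp_apply) (simp add: \<beta>_def)
  have "u \<circ> q \<in> ellis"
    using M_comp[of u q] M_ellis u(1) q(1) by blast
  then have b\<beta>: "(b, \<beta>) \<in> L"
    using ellis_closed_invariant[OF _ L(1,2) y(3)] ub u\<beta> by metis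
  have \<beta>: "u \<beta> = \<beta>"
    using u(2) by (metis \<beta>_def comp_apply)
  have n: "act t \<circ> m \<in> M"
    using m(1) M_left_ideal by (simp add: left_ideal_def)
  have "(m b, m \<beta>) \<in> W" "((act t \<circ> m) b, (act t \<circ> m) \<beta>) \<in> Q"
    using y(1,2) by (simp_all add: m(3) m\<beta> act2_def)
  then show thesis
    by (rule that[OF m(1) n \<beta> b\<beta>])
qed

text \<open>The witnesses for all neighbourhoods \<open>W\<close>, \<open>Q\<close> have a cluster
  point \<open>(m, n)\<close> in the compact set \<open>M \<times> M\<close>. Evaluation at
  \<open>b\<close> and the Hausdorff property identify \<open>m b = b\<close> and
  \<open>n b = x'\<close>; the points \<open>\<beta>\<close> need not converge.\<close>

lemma RP_rel_cluster:
  assumes min: "minimal_dyn act"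
    and L: "closed L" "\<And>t. act2 act t ` L \<subseteq> L" "dense_ap (act2 act) L"
    and u: "u \<in> M" "u \<circ> u = u" "u b = b"
    and RP: "(b, e) \<in> RP_rel act L"
  obtains m n where "m \<in> M" "n \<in> M" "m b = b"
    "\<And>G W Q. \<lbrakk>open G; (m, n) \<in> G; open W; (b, e) \<in> W; open Q; (n b, n b) \<in> Q\<rbrakk> \<Longrightarrow>
      \<exists>m' n' \<beta>. (m', n') \<in> G \<and> m' \<in> M \<and> n' \<in> M \<and> u \<beta> = \<beta> \<and> (b, \<beta>) \<in> L \<and>
        (m' b, m' \<beta>) \<in> W \<and> (n' b, n' \<beta>) \<in> Q"
proof -
  obtain F :: "(('x \<times> 'x) \<times> 't) filter" and x' where F: "F \<noteq> bot"
      "eventually (\<lambda>w. fst w \<in> L) F" "(fst \<longlongrightarrow> (b, e)) F"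
      "((\<lambda>w. act2 act (snd w) (fst w)) \<longlongrightarrow> (x', x')) F"
    using RP unfolding RP_rel_def mem_Collect_eq by (elim conjE exE)
  have x': "\<forall>W Q. open W \<and> (b, e) \<in> W \<and> open Q \<and> (x', x') \<in> Q \<longrightarrow>
    (\<exists>w t. w \<in> L \<and> w \<in> W \<and> act2 act t w \<in> Q)"
  proof (intro allI impI, elim conjE)
    fix W Q :: "('x \<times> 'x) set"
    assume WQ: "open W" "(b, e) \<in> W" "open Q" "(x', x') \<in> Q"
    have "eventually (\<lambda>w. fst w \<in> L \<and> fst w \<in> W \<and> act2 act (snd w) (fst w) \<in> Q) F"
      using F(2) topological_tendstoD[OF F(3) WQ(1,2)] topological_tendstoD[OF F(4) WQ(3,4)]
      by (intro eventually_conj)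
    then show "\<exists>w t. w \<in> L \<and> w \<in> W \<and> act2 act t w \<in> Q"
      using F(1) eventually_happens' by blast
  qed
  define S where "S = (\<lambda>(W, Q). {(m, n). m \<in> M \<and> n \<in> M \<and>
    (\<exists>\<beta>. u \<beta> = \<beta> \<and> (b, \<beta>) \<in> L \<and> (m b, m \<beta>) \<in> W \<and> (n b, n \<beta>) \<in> Q)})"
  define I where "I = {(W, Q). open W \<and> (b, e) \<in> W \<and> open Q \<and> (x', x') \<in> Q}"
  have "(M \<times> M) \<inter> (\<Inter>i\<in>I. closure (S i)) \<noteq> {}"
  proof (rule compact_imp_fip_image)
    show "compact (M \<times> M)"
      by (intro compact_Times M_compact)
    fix J assume J: "finite J" "J \<subseteq> I"
    let ?W = "\<Inter>(fst ` J)" and ?Q = "\<Inter>(snd ` J)"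
    have "open ?W" "(b, e) \<in> ?W" "open ?Q" "(x', x') \<in> ?Q"
      using J by (auto simp: I_def intro!: open_Inter)
    then obtain m n \<beta> where *: "m \<in> M" "n \<in> M" "u \<beta> = \<beta>" "(b, \<beta>) \<in> L"
        "(m b, m \<beta>) \<in> ?W" "(n b, n \<beta>) \<in> ?Q"
      by (rule RP_rel_witness[OF min L u x'])
    then have "(m, n) \<in> S i" if "i \<in> J" for i
      using that by (auto simp: S_def split: prod.split intro!: exI[of _ \<beta>])
    then show "(M \<times> M) \<inter> (\<Inter>i\<in>J. closure (S i)) \<noteq> {}"
      using * closure_subset by blast
  qed simp
  then obtain m n where mn: "m \<in> M" "n \<in> M" "\<And>i. i \<in> I \<Longrightarrow> (m, n) \<in> closure (S i)"
    by blast
  have cluster: "\<exists>m' n' \<beta>. (m', n') \<in> G \<and> m' \<in> M \<and> n' \<in> M \<and> u \<beta> = \<beta> \<and> (b, \<beta>) \<in> L \<and>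
      (m' b, m' \<beta>) \<in> W \<and> (n' b, n' \<beta>) \<in> Q"
    if "open G" "(m, n) \<in> G" "open W" "(b, e) \<in> W" "open Q" "(x', x') \<in> Q" for G W Q
  proof -
    have "(m, n) \<in> closure (S (W, Q))"
      using mn that by (auto simp: I_def)
    then have "G \<inter> S (W, Q) \<noteq> {}"
      using that open_Int_closure_eq_empty[of G "S (W, Q)"] by blast
    then show ?thesis
      unfolding S_def by blast
  qed
  have open_eval: "open {pq. (fst pq :: 'x \<Rightarrow> 'x) b \<in> A}" "open {pq. (snd pq :: 'x \<Rightarrow> 'x) b \<in> A}"
    if "open A" for A :: "'x set"
    using open_vimage_fst[OF open_vimage[OF that continuous_on_product_coordinates]]
      open_vimage_snd[OF open_vimage[OF that continuous_on_product_coordinates]]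
    by (auto simp: vimage_def)
  have "m b = b"
  proof (rule ccontr)
    assume "m b \<noteq> b"
    then obtain A B where AB: "open A" "open B" "m b \<in> A" "b \<in> B" "A \<inter> B = {}"
      by (metis hausdorff)
    have "open (B \<times> (UNIV :: 'x set))"
      using AB(2) by (simp add: open_Times)
    then obtain m' n' \<beta> where "(m', n') \<in> {pq. fst pq b \<in> A}" "(m' b, m' \<beta>) \<in> B \<times> UNIV"
      using cluster[OF open_eval(1)[OF AB(1)], of "B \<times> UNIV" UNIV] AB(3,4) by auto
    then show False
      using AB(5) by auto
  qed
  moreover have "n b = x'"
  proof (rule ccontr)
    assume "n b \<noteq> x'"
    then obtain A B where AB: "open A" "open B" "n b \<in> A" "x' \<in> B" "A \<inter> B = {}"
      by (metis hausdorff)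
    have "open (B \<times> (UNIV :: 'x set))"
      using AB(2) by (simp add: open_Times)
    then obtain m' n' \<beta> where "(m', n') \<in> {pq. snd pq b \<in> A}" "(n' b, n' \<beta>) \<in> B \<times> UNIV"
      using cluster[OF open_eval(2)[OF AB(1)], of UNIV "B \<times> UNIV"] AB(3,4) by auto
    then show False
      using AB(5) by auto
  qed
  ultimately show thesis
    using that mn cluster by blast
qed

section \<open>Spreading from a relatively open set to all almost periodic pairs\<close>

text \<open>The core case, in which the two pairs share the coordinate \<open>a\<close> and the
  idempotent \<open>u\<close>; other almost periodic pairs are moved into this position
  afterwards.\<close>

lemma fixed_pair_in_interior_orbit:
  assumes min: "minimal_dyn act"
    and L: "closed L" "\<And>t. act2 act t ` L \<subseteq> L" "dense_ap (act2 act) L" "AP_transitive act p L"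
    and RP: "RP_rel act L = L"
    and N: "closed N" "\<And>t. act2 act t ` N \<subseteq> N"
    and U: "open U" "U \<inter> L \<subseteq> N" "(a, b) \<in> U" "(a, b) \<in> L"
    and u: "u \<in> M" "u \<circ> u = u" "u a = a" "u b = b"
    and e: "u e = e" "(a, e) \<in> L"
  shows "(a, e) \<in> N"
proof -
  have trans: "(x, z) \<in> L" if "(x, y) \<in> L" "(y, z) \<in> L" "u x = x" "u y = y" "u z = z" for x y z
    using L(4) that fixed_imp_ap_point[OF u(1)] unfolding AP_transitive_def by blast
  have sym: "(y, x) \<in> L" if "(x, y) \<in> L" for x y
    using L(4) that unfolding AP_transitive_def by blast
  have "(b, e) \<in> RP_rel act L"
    using trans[OF sym[OF U(4)] e(2)] u e RP by simp
  then obtain m n where mn: "m \<in> M" "n \<in> M" "m b = b"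
    and cluster: "\<And>G W Q. \<lbrakk>open G; (m, n) \<in> G; open W; (b, e) \<in> W; open Q; (n b, n b) \<in> Q\<rbrakk> \<Longrightarrow>
      \<exists>m' n' \<beta>. (m', n') \<in> G \<and> m' \<in> M \<and> n' \<in> M \<and> u \<beta> = \<beta> \<and> (b, \<beta>) \<in> L \<and>
        (m' b, m' \<beta>) \<in> W \<and> (n' b, n' \<beta>) \<in> Q"
    using RP_rel_cluster[OF min L(1-3) u(1,2,4)] by metis
  define g where "g = u \<circ> m"
  have g: "g \<in> M" "u \<circ> g = g" "g b = b"
    using u mn M_comp M_ellis by (auto simp: g_def comp_assoc[symmetric])
  obtain g' where g': "g' \<in> M" "u \<circ> g' = g'" "g' \<circ> g = u" "g \<circ> g' = u"
    using idempotent_group_inverse[OF u(1,2) g(1,2)] .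
  \<comment> \<open>\<open>m\<close> fixes \<open>b\<close> but may move \<open>a\<close>; starting from \<open>z\<close> instead of \<open>a\<close> compensates for this.\<close>
  define z where "z = g' a"
  have z: "u z = z" "g z = a" "g' b = b"
    using g' g(3) u(3,4) by (metis comp_apply z_def)+
  have zbL: "(z, b) \<in> L"
    using ellis_closed_invariant[of g' L a b] L g'(1) M_ellis U(4) z by (auto simp: z_def)
  obtain n' where n': "n' \<in> M" "n' \<circ> n = u"
    using M_solve_left[OF mn(2) u(1)] .
  \<comment> \<open>Since \<open>n' \<circ> n = u\<close>, \<open>r\<close> takes \<open>n z\<close>
    to \<open>g z = a\<close> and \<open>n b\<close> to \<open>g b = b\<close>, that is, into
    \<open>U\<close>.\<close>
  define r where "r = g \<circ> n'"
  have r: "r \<in> ellis" "r (n z) = a" "r (n b) = b"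
    using M_comp[of g n'] g n' M_ellis z u(4) by (auto simp: r_def)
  then obtain s where s: "(act s (n z), act s (n b)) \<in> U"
    using ellis_approx_pair[OF r(1) U(1), of "n z" "n b"] U(3) by auto
  have "open (act2 act s -` U)"
    using U(1) act2_continuous by (rule open_vimage)
  moreover have "(n z, n b) \<in> act2 act s -` U"
    using s by (simp add: act2_def)
  ultimately obtain A B where AB: "open A" "open B" "n z \<in> A" "n b \<in> B" "A \<times> B \<subseteq> act2 act s -` U"
    by (auto elim!: open_prod_elim)
  have "(m z, e) \<in> N"
  proof (rule ccontr)
    assume "(m z, e) \<notin> N"
    then have "open (- N)" "(m z, e) \<in> - N"
      using N(1) by auto
    then obtain C D where CD: "open C" "open D" "m z \<in> C" "e \<in> D" "C \<times> D \<subseteq> - N"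
      by (auto elim!: open_prod_elim)
    \<comment> \<open>\<open>G\<close> controls \<open>m'\<close> and \<open>n'\<close> at
      \<open>z\<close>, while \<open>D\<close> and \<open>B\<close> control their values at
      \<open>\<beta>\<close>.\<close>
    define G where "G = ((\<lambda>p. p z) -` C) \<times> ((\<lambda>p :: 'x \<Rightarrow> 'x. p z) -` A)"
    have "open G"
      unfolding G_def using CD AB by (intro open_Times open_vimage continuous_on_product_coordinates)
    moreover have "(m, n) \<in> G"
      using CD AB by (auto simp: G_def)
    ultimately obtain m' n' \<beta> where *: "(m', n') \<in> G" "m' \<in> M" "n' \<in> M" "u \<beta> = \<beta>" "(b, \<beta>) \<in> L"
        "(m' b, m' \<beta>) \<in> UNIV \<times> D" "(n' b, n' \<beta>) \<in> UNIV \<times> B"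
      using cluster[of G "UNIV \<times> D" "UNIV \<times> B"] CD AB by (auto simp: open_Times)
    have z\<beta>: "(z, \<beta>) \<in> L"
      using trans[OF zbL *(5)] z u * by auto
    \<comment> \<open>\<open>k\<close> carries \<open>(z, \<beta>)\<close> into \<open>U\<close> and
      stays in \<open>L\<close>, hence lands in \<open>N\<close>; an \<open>l\<close> with
      \<open>l \<circ> k = u\<close> brings the pair back, so it was in \<open>N\<close>
      already.\<close>
    define k where "k = act s \<circ> n'"
    have k: "k \<in> M"
      using * M_left_ideal by (auto simp: k_def left_ideal_def)
    have "(k z, k \<beta>) \<in> U"
      using AB(5) * by (auto simp: k_def G_def act2_def)
    moreover have "(k z, k \<beta>) \<in> L"
      using ellis_closed_invariant[of k L z \<beta>] k M_ellis L z\<beta> by auto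
    ultimately have kN: "(k z, k \<beta>) \<in> N"
      using U(2) by blast
    obtain l where l: "l \<in> M" "l \<circ> k = u"
      using M_solve_left[OF k u(1)] .
    then have "l (k z) = z" "l (k \<beta>) = \<beta>"
      using z *(4) by (metis comp_apply)+
    then have "(z, \<beta>) \<in> N"
      using ellis_closed_invariant[of l N "k z" "k \<beta>"] l(1) M_ellis N kN by auto
    then have "(m' z, m' \<beta>) \<in> N"
      using ellis_closed_invariant[of m' N z \<beta>] *(2) M_ellis N by auto
    then show False
      using CD(5) * by (auto simp: G_def)
  qed
  then have "(u (m z), u e) \<in> N"
    using ellis_closed_invariant[of u N "m z" e] u(1) M_ellis N by auto
  then show ?thesis
    using z(2) e(1) by (simp add: g_def)
qed

text \<open>An element of \<open>M\<close> moves \<open>c\<close> to \<open>a\<close>, the core case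
  applies, and another element of \<open>M\<close> moves the pair back.\<close>

lemma ap_point_in_interior_orbit:
  assumes min: "minimal_dyn act"
    and L: "closed L" "\<And>t. act2 act t ` L \<subseteq> L" "dense_ap (act2 act) L" "AP_transitive act p L"
    and RP: "RP_rel act L = L"
    and N: "closed N" "\<And>t. act2 act t ` N \<subseteq> N"
    and U: "open U" "U \<inter> L \<subseteq> N" "U \<inter> L \<noteq> {}"
    and cd: "(c, d) \<in> L" "ap_point (act2 act) (c, d)"
  shows "(c, d) \<in> N"
proof -
  have "U \<inter> closure {z\<in>L. ap_point (act2 act) z} \<noteq> {}"
    using U L(3) by (auto simp: dense_ap_def)
  then have "U \<inter> {z\<in>L. ap_point (act2 act) z} \<noteq> {}"
    using U(1) open_Int_closure_eq_empty by blast
  then obtain a b where ab: "(a, b) \<in> U" "(a, b) \<in> L" "ap_point (act2 act) (a, b)"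
    by auto
  obtain u where u: "u \<in> M" "u \<circ> u = u" "u a = a" "u b = b"
    using ap_point_imp_idempotent[OF ab(3)] .
  obtain w where w: "w \<in> M" "w \<circ> w = w" "w c = c" "w d = d"
    using ap_point_imp_idempotent[OF cd(2)] .
  obtain q where q: "q \<in> M" "q c = a"
    using M_orbit_eq_UNIV[OF min] .
  \<comment> \<open>The factor \<open>u\<close> makes the image of \<open>d\<close> fixed by
    \<open>u\<close>, while the image of \<open>c\<close> remains \<open>u a = a\<close>.\<close>
  define q' where "q' = u \<circ> q"
  have q': "q' \<in> M" "q' c = a" "u (q' d) = q' d"
    using q u M_comp M_ellis by (auto simp: q'_def) (metis comp_apply)
  have "(a, q' d) \<in> L"
    using ellis_closed_invariant[of q' L c d] q' M_ellis L cd by auto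
  then have aN: "(a, q' d) \<in> N"
    using fixed_pair_in_interior_orbit[OF min L RP N U(1,2) ab(1,2) u q'(3)] by simp
  obtain r where r: "r \<in> M" "r \<circ> q' = w"
    using M_solve_left[OF q'(1) w(1)] .
  then have "r a = c" "r (q' d) = d"
    using w(3,4) q'(2) by (metis comp_apply)+
  then show ?thesis
    using ellis_closed_invariant[of r N a "q' d"] r(1) M_ellis N aN by auto
qed

end

section \<open>Existence of the ideal and topological transitivity\<close>

lemma (in compact_semiflow) ellis_minimal_ideal_exists:
  obtains M where "ellis_minimal_ideal act M"
proof -
  have I: "left_ideal (\<Inter>C)" if "\<And>A. A \<in> C \<Longrightarrow> left_ideal A" for C
    using that by (auto simp: left_ideal_def)
  obtain M where "M \<subseteq> ellis" "closed M" "M \<noteq> {}" "left_ideal M"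
    "\<And>B. \<lbrakk>B \<subseteq> M; closed B; B \<noteq> {}; left_ideal B\<rbrakk> \<Longrightarrow> B = M"
    using compact_minimal_closed_subset[of ellis left_ideal, OF compact_UNIV_fun[OF compact_space]
        _ _ left_ideal_ellis I] act_in_ellis
    by (metis closed_closure ellis_def empty_iff)
  then have "ellis_minimal_ideal act M"
    by unfold_locales
  then show thesis by (rule that)
qed

theorem theorem2p2:
  fixes actX :: "'t::monoid_mult \<Rightarrow> 'x::t2_space \<Rightarrow> 'x"
    and actY :: "'t \<Rightarrow> 'y::t2_space \<Rightarrow> 'y"
    and p :: "'x \<Rightarrow> 'y"
    and L :: "('x \<times> 'x) set"
  assumes "compact (UNIV :: 'x set)" and "compact (UNIV :: 'y set)"
    and "semiflow actX" and "semiflow actY"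
    and "minimal_dyn actX" and "minimal_dyn actY"
    and "extension actX actY p"
    and "closed L" and "\<forall>t. act2 actX t ` L \<subseteq> L"
    and "AP_transitive actX p L"
    and "dense_ap (act2 actX) L"
    and "RP_rel actX L = L"
  shows "M_dyn (act2 actX) L"
proof -
  interpret compact_semiflow actX
    using assms by unfold_locales
  obtain M where "ellis_minimal_ideal actX M"
    using ellis_minimal_ideal_exists .
  then interpret ellis_minimal_ideal actX M .
  have "top_trans (act2 actX) L"
    unfolding top_trans_def
  proof (intro allI impI)
    fix U V
    assume UV: "openin (top_of_set L) U \<and> U \<noteq> {} \<and> openin (top_of_set L) V \<and> V \<noteq> {}"
    then obtain U' V' where U': "open U'" "U = U' \<inter> L" and V': "open V'" "V = V' \<inter> L"
      by (auto simp: openin_open)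
    \<comment> \<open>The closure of the full orbit of \<open>U\<close> is the closed invariant set
      to which \<open>ap_point_in_interior_orbit\<close> applies.\<close>
    define TU where "TU = (\<Union>t. act2 actX t ` U)"
    have "act2 actX t ` closure TU \<subseteq> closure TU" for t
    proof (rule image_closure_subset[OF continuous_on_subset[OF act2_continuous]])
      have "act2 actX t (act2 actX s z) = act2 actX (t * s) z" for s z
        by (simp add: act2_def act_mult)
      then have "act2 actX t ` act2 actX s ` U = act2 actX (t * s) ` U" for s
        by (simp add: image_image)
      then have "act2 actX t ` TU \<subseteq> TU"
        unfolding TU_def image_UN by (intro UN_least) (simp, rule UN_upper, simp)
      then show "act2 actX t ` TU \<subseteq> closure TU"
        using closure_subset by blast
    qed auto
    moreover have "act2 actX 1 z = z" for z
      by (simp add: act2_def)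
    then have "U \<subseteq> TU"
      using UN_upper[of 1 UNIV "\<lambda>t. act2 actX t ` U"] by (simp add: TU_def)
    then have "U' \<inter> L \<subseteq> closure TU"
      using U' closure_subset by blast
    ultimately have ap: "z \<in> closure TU" if "z \<in> L" "ap_point (act2 actX) z" for z
      using ap_point_in_interior_orbit[of L p "closure TU" U' "fst z" "snd z"] assms U' UV that
      by simp
    \<comment> \<open>By density \<open>V'\<close> contains an almost periodic point of
      \<open>L\<close>; this point lies in \<open>closure TU\<close>, so the open set
      \<open>V'\<close> meets \<open>TU\<close> itself.\<close>
    have "V' \<inter> closure {z\<in>L. ap_point (act2 actX) z} \<noteq> {}"
      using V' UV assms(11) by (auto simp: dense_ap_def)
    then have "V' \<inter> {z\<in>L. ap_point (act2 actX) z} \<noteq> {}"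
      using V'(1) open_Int_closure_eq_empty by blast
    then have "V' \<inter> closure TU \<noteq> {}"
      using ap by blast
    then have "V' \<inter> TU \<noteq> {}"
      using V'(1) open_Int_closure_eq_empty by blast
    moreover have "TU \<subseteq> L"
      using assms(9) U' by (auto simp: TU_def)
    ultimately show "\<exists>t. V \<inter> act2 actX t ` U \<noteq> {}"
      using V' by (auto simp: TU_def)
  qed
  then show ?thesis
    using assms by (simp add: M_dyn_def)
qed

end
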